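(* Let $p<q$ be prime numbers, let $\mathcal{A}=\{-1,0,1\}$, let $s=\lfloor q/p\rfloor$ and $r=q \bmod p$. Define $\boldsymbol{d}_0=1\,(-1)\,0\cdots 0\in\mathcal{A}^p$ (a $1$, then a $-1$, then $p-2$ zeros), and $\boldsymbol{d}_i=\sigma^{q}(\boldsymbol{d}_{i-1})=\sigma^{iq}(\boldsymbol{d}_0)$ for $i\ge 1$. Define $\boldsymbol{\omega}_0=\boldsymbol{d}_0$ and $\boldsymbol{\omega}_i=\boldsymbol{\omega}_{i-1}+\boldsymbol{d}_i$ for $1\le i\le p-2$ (coordinatewise integer addition). Then: 1. The words $\boldsymbol{\omega}_0,\dots,\boldsymbol{\omega}_{p-2}$ belong to $\mathcal{A}^p$, i.e. each addition $\boldsymbol{\omega}_{i-1}+\boldsymbol{d}_i$ never produces $1+1$ or $(-1)+(-1)$ in any coordinate. These $p-1$ words depend only on the pair $(p,r)$. 2. The cyclotomic word $\boldsymbol{a}_{pq}$ coincides with the prefix of length $\varphi(pq)+1$ of the word $$\boldsymbol{b}_{pq}=\boldsymbol{\omega}_0^s\cdot\boldsymbol{\omega}_0^{r/p}\cdot\boldsymbol{\omega}_1^s\cdot\boldsymbol{\omega}_1^{r/p}\cdots\boldsymbol{\omega}_{p-2}^s\cdot\boldsymbol{\omega}_{p-2}^{r/p}\in\mathcal{A}^{(p-1)q},$$ and in fractional power notation $$\boldsymbol{a}_{pq}=\boldsymbol{\omega}_0^{q/p}\cdot\boldsymbol{\omega}_1^{q/p}\cdots\boldsymbol{\omega}_{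p-3}^{q/p}\cdot\boldsymbol{\omega}_{p-2}^{(q-p+2)/p}.$$
   Context: For coprime $n$, $\Phi_n$ denotes the $n$-th cyclotomic polynomial; for distinct primes $p,q$, $\Phi_{pq}$ has degree $m=\varphi(pq)=(p-1)(q-1)$ and integer coefficients. The cyclotomic word $\boldsymbol{a}_{pq}=a_0a_1\cdots a_m$ is the sequence of coefficients of $\Phi_{pq}(x)=\sum_{i=0}^m a_ix^i$, viewed as a word. Words are finite sequences over $\mathcal{A}$; $\boldsymbol{u}\cdot\boldsymbol{v}$ is concatenation, $\boldsymbol{v}^s$ is the $s$-fold concatenation ($\boldsymbol{v}^0$ is the empty word). For $\boldsymbol{v}\in\mathcal{A}^p$ and an integer $k\ge 0$, the fractional power $\boldsymbol{v}^{k/p}\in\mathcal{A}^k$ is: the prefix of $\boldsymbol{v}$ of length $k$ if $k<p$, and $\boldsymbol{v}^{\lfloor k/p\rfloor}\cdot\boldsymbol{v}^{(k\bmod p)/p}$ if $k\ge p$. The left circular permutation $\sigma:\mathcal{A}^p\to\mathcal{A}^p$ is $\sigma(v_0v_1\cdots v_{p-1})=v_1\cdots v_{p-1}v_0$, so $\sigma^p=\mathrm{Id}$. The sum of two words of equal length is the coordinatewise sum in $\mathbb{Z}$. *)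

theory Defs
  imports
    Complex_Main
    "HOL-Library.NList"
    "HOL-Computational_Algebra.Polynomial"
    "HOL-Number_Theory.Totient"
begin

text \<open>
  The cyclotomic polynomial is the product of the linear factors of the primitive complex roots
  of unity, hence has complex coefficients; integer words are compared with its coefficient word
  through \<^const>\<open>of_int\<close>.
\<close>

definition cyclotomic :: "nat \<Rightarrow> complex poly" where
  "cyclotomic n = (\<Prod>k\<in>totatives n. [:- cis (2 * pi * real k / real n), 1:])"

lemma degree_cyclotomic: "degree (cyclotomic n) = totient n"
  unfolding cyclotomic_def totient_def by (subst degree_prod_eq_sum_degree) auto

definition cyclotomic_word :: "nat \<Rightarrow> complex list" where
  "cyclotomic_word n = coeffs (cyclotomic n)"

lemma length_cyclotomic_word: "length (cyclotomic_word n) = totient n + 1"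
proof -
  have "cyclotomic n \<noteq> 0"
    by (auto simp: cyclotomic_def)
  then show ?thesis
    by (simp add: cyclotomic_word_def length_coeffs_degree degree_cyclotomic)
qed

definition word_pow :: "'a list \<Rightarrow> nat \<Rightarrow> 'a list" where
  "word_pow v s = concat (replicate s v)"

text \<open>\<open>frac_pow v k\<close> is the fractional power of \<open>v\<close> with exponent \<open>k / length v\<close>.\<close>

definition frac_pow :: "'a list \<Rightarrow> nat \<Rightarrow> 'a list" where
  "frac_pow v k =
     (if k < length v then take k v
      else word_pow v (k div length v) @ take (k mod length v) v)"

definition word_add :: "int list \<Rightarrow> int list \<Rightarrow> int list" where
  "word_add u v = map2 (+) u v"

primrec d_word :: "nat \<Rightarrow> nat \<Rightarrow> nat \<Rightarrow> int list" where
  "d_word p q 0 = [1, -1] @ replicate (p - 2) 0"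
| "d_word p q (Suc i) = rotate q (d_word p q i)"

lemma d_word_eq_rotate: "d_word p q i = rotate (i * q) (d_word p q 0)"
  by (induction i) (simp_all add: rotate_rotate)

primrec omega_word :: "nat \<Rightarrow> nat \<Rightarrow> nat \<Rightarrow> int list" where
  "omega_word p q 0 = d_word p q 0"
| "omega_word p q (Suc i) = word_add (omega_word p q i) (d_word p q (Suc i))"

definition b_word :: "nat \<Rightarrow> nat \<Rightarrow> int list" where
  "b_word p q =
     concat (map (\<lambda>i. word_pow (omega_word p q i) (q div p) @ frac_pow (omega_word p q i) (q mod p))
       [0..<p - 1])"

end

(*
  Comparing roots of unity gives Phi_pq(x) (1 - x^p) = (1 - x) (1 + x^q + ... + x^((p-1)q)).
  Let c be the p-periodic sequence of coefficients of (1 - x) / (1 - x^p), which is 1 at multiples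
  of p, -1 at their successors and 0 elsewhere. Then for kq <= n < (k+1)q with k < p the n-th
  coefficient of Phi_pq is the sum of c(n - iq) over i <= k. Since d_i has entries c(j + iq), the
  word omega_k has entries given by the sum of c(j + iq) over i <= k, and substituting i -> k - i
  identifies the n-th coefficient with entry (n - kq) mod p of omega_k.
*)

theory Submission
  imports Defs "HOL-Computational_Algebra.Fundamental_Theorem_Algebra"
begin

section \<open>Roots of unity and a product identity for the cyclotomic polynomial\<close>

text \<open>The polynomial \<open>x^n - 1\<close> shares no root with its derivative, so it is
  squarefree and splits as the product over its distinct complex roots.\<close>

lemma prod_root_of_unity_factors:
  fixes n :: nat
  assumes "n > 0"
  shows "(\<Prod>k\<in>{0<..n}. [:- cis (2 * pi * real k / real n), 1:]) = monom 1 n - 1"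
proof -
  let ?P = "monom 1 n - 1 :: complex poly"
  have root_iff: "poly ?P z = 0 \<longleftrightarrow> z ^ n = 1" for z
    by (simp add: poly_monom)
  have deg: "degree ?P = n"
    using assms by (intro antisym degree_diff_le le_degree) (auto simp: degree_monom_le)
  have lead: "lead_coeff ?P = 1"
    using assms by (subst deg) simp
  have "rsquarefree ?P"
    using assms by (auto simp: rsquarefree_roots pderiv_diff pderiv_monom poly_monom
        power_0_left)
  then have "?P = (\<Prod>z | z ^ n = 1. [:- z, 1:])"
    using complex_poly_decompose_rsquarefree[of ?P] lead root_iff by simp
  also have "\<dots> = (\<Prod>k<n. [:- cis (2 * pi * real k / real n), 1:])"
    using prod.reindex_bij_betw[OF bij_betw_roots_unity[OF assms], of "\<lambda>z. [:- z, 1:]"] by simp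
  \<comment> \<open>The indices \<open>0\<close> and \<open>n\<close> give the same root
    \<open>1\<close>; trading them yields the range \<open>{0<..n}\<close>, which contains the
    totatives.\<close>
  also have "{..<n} = insert 0 {0<..<n}"
    using assms by auto
  also have "(\<Prod>k\<in>insert 0 {0<..<n}. [:- cis (2 * pi * real k / real n), 1:]) =
      (\<Prod>k\<in>insert n {0<..<n}. [:- cis (2 * pi * real k / real n), 1:])"
    using assms by simp
  also have "insert n {0<..<n} = {0<..n}"
    using assms by auto
  finally show ?thesis ..
qed

text \<open>The factor \<open>m\<close> cancels in the angle, so the multiples of \<open>m\<close>
  index exactly the \<open>n\<close>-th roots among the \<open>m * n\<close>-th roots of
  unity.\<close>

lemma prod_multiples_root_of_unity_factors:
  fixes m n :: nat
  assumes "m > 0" "n > 0"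
  shows "(\<Prod>k\<in>(*) m ` {0<..n}. [:- cis (2 * pi * real k / real (m * n)), 1:]) = monom 1 n - 1"
proof -
  have "inj_on ((*) m) {0<..n}"
    using assms by (auto intro: inj_onI)
  then have "(\<Prod>k\<in>(*) m ` {0<..n}. [:- cis (2 * pi * real k / real (m * n)), 1:]) =
      (\<Prod>k\<in>{0<..n}. [:- cis (2 * pi * real (m * k) / real (m * n)), 1:])"
    by (simp add: prod.reindex)
  also have "\<dots> = (\<Prod>k\<in>{0<..n}. [:- cis (2 * pi * real k / real n), 1:])"
    using assms by (intro prod.cong) (simp_all add: mult.left_commute)
  finally show ?thesis
    using prod_root_of_unity_factors[OF assms(2)] by simp
qed

text \<open>Inclusion-exclusion on the exponents up to \<open>p * q\<close>: those that are not
  totatives are the multiples of \<open>p\<close> (set \<open>A\<close>) or of \<open>q\<close> (set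
  \<open>B\<close>), and these two sets share only \<open>p * q\<close>, whose factor is
  \<open>x - 1\<close>.\<close>

lemma cyclotomic_prime_mult:
  fixes p q :: nat
  assumes "prime p" "prime q" "p \<noteq> q"
  shows "cyclotomic (p * q) * (monom 1 p - 1) * (monom 1 q - 1) =
    (monom 1 (p * q) - 1) * (monom 1 1 - 1)"
proof -
  define f where "f k = [:- cis (2 * pi * real k / real (p * q)), 1:]" for k
  define A where "A = (*) p ` {0<..q}"
  define B where "B = (*) q ` {0<..p}"
  have pos: "p > 0" "q > 0"
    using assms by (auto simp: prime_gt_0_nat)
  have cop: "coprime p q"
    using assms by (simp add: primes_coprime)
  have A: "A = {k\<in>{0<..p * q}. p dvd k}" and B: "B = {k\<in>{0<..p * q}. q dvd k}"
    using pos by (auto simp: A_def B_def mult.commute elim!: dvdE)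
  have coprime_iff: "coprime k (p * q) \<longleftrightarrow> \<not> p dvd k \<and> \<not> q dvd k" for k
    using assms by (metis coprime_commute coprime_mult_right_iff coprime_absorb_left
        not_prime_unit prime_imp_coprime)
  have T: "totatives (p * q) = {k\<in>{0<..p * q}. \<not> p dvd k \<and> \<not> q dvd k}"
    unfolding totatives_def coprime_iff by auto
  have union: "{0<..p * q} = totatives (p * q) \<union> (A \<union> B)"
    by (auto simp: A B T)
  have disj: "totatives (p * q) \<inter> (A \<union> B) = {}"
    by (auto simp: A B T)
  have inter: "A \<inter> B = {p * q}"
  proof -
    have "k = p * q" if "0 < k" "k \<le> p * q" "p dvd k" "q dvd k" for k
      using that cop by (meson divides_mult dvd_imp_le le_antisym)
    then show ?thesis
      using pos by (auto simp: A B)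
  qed
  have fin: "finite A" "finite B"
    by (simp_all add: A B)
  have pA: "prod f A = monom 1 q - 1"
    using prod_multiples_root_of_unity_factors[of p q] pos by (simp add: A_def f_def)
  have pB: "prod f B = monom 1 p - 1"
    using prod_multiples_root_of_unity_factors[of q p] pos
    by (simp add: B_def f_def mult.commute[of q p])
  have "prod f {p * q} = monom 1 1 - 1"
    using pos by (simp add: f_def monom_altdef one_pCons)
  then have pAB: "prod f (A \<inter> B) = monom 1 1 - 1"
    by (simp add: inter)
  have "monom 1 (p * q) - 1 = prod f {0<..p * q}"
    using prod_root_of_unity_factors[of "p * q"] pos by (simp add: f_def)
  also have "\<dots> = cyclotomic (p * q) * prod f (A \<union> B)"
    unfolding union using disj fin
    by (subst prod.union_disjoint) (auto simp: cyclotomic_def f_def)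
  \<comment> \<open>Multiplying by the product over the intersection, rather than dividing by it,
    keeps the identity among polynomials.\<close>
  finally have "(monom 1 (p * q) - 1) * prod f (A \<inter> B) =
      cyclotomic (p * q) * (prod f (A \<union> B) * prod f (A \<inter> B))"
    by (simp add: mult.assoc)
  also have "prod f (A \<union> B) * prod f (A \<inter> B) = prod f A * prod f B"
    using prod.union_inter[OF fin] by simp
  finally show ?thesis
    by (simp only: pA pB pAB) (simp only: mult_ac)
qed

text \<open>Expands \<open>x^(pq) - 1\<close> as a geometric sum in \<open>x^q\<close> and cancels
  the common factor \<open>x^q - 1\<close>.\<close>

lemma cyclotomic_prime_mult_eq_sum:
  fixes p q :: nat
  assumes "prime p" "prime q" "p \<noteq> q"
  shows "cyclotomic (p * q) * (monom 1 p - 1) = (monom 1 1 - 1) * (\<Sum>i<p. monom 1 (i * q))"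
proof -
  have "(monom 1 (p * q) - 1 :: complex poly) = monom 1 q ^ p - 1"
    by (simp add: monom_power mult.commute)
  also have "\<dots> = (monom 1 q - 1) * (\<Sum>i<p. monom 1 q ^ i)"
    by (rule power_diff_1_eq)
  also have "(\<Sum>i<p. monom 1 q ^ i :: complex poly) = (\<Sum>i<p. monom 1 (i * q))"
    by (simp add: monom_power mult.commute)
  finally have "(monom 1 q - 1) * (cyclotomic (p * q) * (monom 1 p - 1)) =
      (monom 1 q - 1) * ((monom 1 1 - 1) * (\<Sum>i<p. monom 1 (i * q)))"
    using cyclotomic_prime_mult[OF assms] by (simp add: mult_ac)
  moreover have "coeff (monom 1 q - 1 :: complex poly) q \<noteq> 0"
    using prime_gt_0_nat[OF assms(2)] by simp
  then have "(monom 1 q - 1 :: complex poly) \<noteq> 0"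
    by (metis coeff_0)
  ultimately show ?thesis
    by (simp del: mult_cancel_left add: mult_left_cancel)
qed

section \<open>Coefficients of the cyclotomic polynomial as sums of a periodic sequence\<close>

text \<open>
  The sequence of coefficients of \<open>(1 - x) / (1 - x\<^sup>p)\<close>, extended periodically to negative indices.
\<close>

definition residue_diff :: "nat \<Rightarrow> int \<Rightarrow> int" where
  "residue_diff p m = of_bool (int p dvd m) - of_bool (int p dvd m - 1)"

lemma residue_diff_cong:
  assumes "[m = n] (mod int p)"
  shows "residue_diff p m = residue_diff p n"
  using cong_dvd_iff[OF assms] cong_dvd_iff[OF cong_diff[OF assms cong_refl[of 1]]]
  by (simp add: residue_diff_def)

text \<open>Coefficient form of \<open>(1 - x^p) * c(x) = 1 - x\<close>, where \<open>c\<close> is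
  the power series of \<open>(1 - x) / (1 - x^p)\<close>; the indicators cut the periodic sequence
  off below index \<open>0\<close>.\<close>

lemma residue_diff_truncated:
  assumes "p \<ge> 2"
  shows "of_bool (0 \<le> m) * residue_diff p m - of_bool (int p \<le> m) * residue_diff p (m - int p) =
    of_bool (m = 0) - of_bool (m = 1)"
proof -
  have per: "residue_diff p (m - int p) = residue_diff p m"
    by (rule residue_diff_cong) (simp add: cong_def)
  consider "m < 0" | "int p \<le> m" | "m = 0" | "m = 1" | "1 < m" "m < int p"
    by linarith
  then show ?thesis
  proof cases
    case 5
    then have "\<not> int p dvd m" "\<not> int p dvd m - 1"
      by (auto dest: zdvd_imp_le)
    with 5 show ?thesis
      by (simp add: residue_diff_def)
  qed (use assms per in \<open>auto simp: residue_diff_def\<close>)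
qed

text \<open>Multiplication by \<open>1 - x^p\<close> determines each coefficient from the one
  \<open>p\<close> places earlier. Both sides obey this recurrence, with the coefficients of the sum
  of all \<open>x^(iq) - x^(iq+1)\<close> as inhomogeneous term.\<close>

lemma coeff_cyclotomic_prime_mult:
  fixes p q n :: nat
  assumes "prime p" "prime q" "p \<noteq> q"
  shows "coeff (cyclotomic (p * q)) n =
    of_int (\<Sum>i<p. of_bool (i * q \<le> n) * residue_diff p (int n - int (i * q)))"
    (is "_ = of_int (?A n)")
proof (induction n rule: less_induct)
  case (less n)
  let ?a = "coeff (cyclotomic (p * q))"
  have p2: "p \<ge> 2"
    using assms prime_ge_2_nat by blast
  have rec: "?A n - of_bool (p \<le> n) * ?A (n - p) =
      (\<Sum>i<p. of_bool (n = i * q) - of_bool (n = Suc (i * q)))"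
  proof -
    have "of_bool (i * q \<le> n) * residue_diff p (int n - int (i * q)) -
        of_bool (p \<le> n) * (of_bool (i * q \<le> n - p) * residue_diff p (int (n - p) - int (i * q))) =
        of_bool (n = i * q) - of_bool (n = Suc (i * q))" for i
    proof -
      \<comment> \<open>The two guards on natural numbers merge into one integer inequality, so
        truncated subtraction in \<open>n - p\<close> does no harm.\<close>
      have "of_bool (p \<le> n) * (of_bool (i * q \<le> n - p) * residue_diff p (int (n - p) - int (i * q))) =
          of_bool (int p \<le> int n - int (i * q)) * residue_diff p (int n - int (i * q) - int p)"
      proof -
        have "int p \<le> int n - int (i * q) \<longleftrightarrow> p \<le> n \<and> i * q \<le> n - p"
          by linarith
        moreover have "residue_diff p (int (n - p) - int (i * q)) =
            residue_diff p (int n - int (i * q) - int p)" if "p \<le> n"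
          using that by (simp add: algebra_simps)
        ultimately show ?thesis
          by (cases "p \<le> n") simp_all
      qed
      moreover have "int n - int (i * q) = 0 \<longleftrightarrow> n = i * q"
        and "int n - int (i * q) = 1 \<longleftrightarrow> n = Suc (i * q)"
        and "0 \<le> int n - int (i * q) \<longleftrightarrow> i * q \<le> n"
        by linarith+
      ultimately show ?thesis
        using residue_diff_truncated[OF p2, of "int n - int (i * q)"] by simp
    qed
    then show ?thesis
      by (simp only: sum_distrib_left sum_subtractf[symmetric])
  qed
  have "(monom 1 p - 1) * cyclotomic (p * q) =
      (\<Sum>i<p. monom 1 (Suc (i * q)) - monom 1 (i * q))"
    using cyclotomic_prime_mult_eq_sum[OF assms]
    by (simp add: mult.commute[of "cyclotomic (p * q)"] sum_distrib_left left_diff_distrib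
        mult_monom sum_subtractf)
  then have "coeff ((monom 1 p - 1) * cyclotomic (p * q)) n =
      (\<Sum>i<p. coeff (monom 1 (Suc (i * q)) - monom 1 (i * q)) n)"
    by (simp only: coeff_sum)
  also have "\<dots> = (\<Sum>i<p. of_bool (n = Suc (i * q)) - of_bool (n = i * q))"
    by (intro sum.cong) auto
  also have "coeff ((monom 1 p - 1) * cyclotomic (p * q)) n = of_bool (p \<le> n) * ?a (n - p) - ?a n"
    by (simp add: left_diff_distrib coeff_monom_mult)
  finally have "?a n = of_bool (p \<le> n) * ?a (n - p) -
      (\<Sum>i<p. of_bool (n = Suc (i * q)) - of_bool (n = i * q))"
    by (simp only: algebra_simps)
  then have "?a n = of_bool (p \<le> n) * ?a (n - p) +
      (\<Sum>i<p. of_bool (n = i * q) - of_bool (n = Suc (i * q)))"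
    by (simp only: sum_subtractf) simp
  \<comment> \<open>The induction hypothesis is needed only when \<open>p \<le> n\<close>, where
    \<open>n - p < n\<close> because \<open>p\<close> is positive.\<close>
  also have "of_bool (p \<le> n) * ?a (n - p) = of_int (of_bool (p \<le> n) * ?A (n - p))"
    using less.IH[of "n - p"] p2 by (cases "p \<le> n") auto
  also have "(\<Sum>i<p. of_bool (n = i * q) - of_bool (n = Suc (i * q)) :: complex) =
      of_int (\<Sum>i<p. of_bool (n = i * q) - of_bool (n = Suc (i * q)))"
    by simp
  also have "of_int (of_bool (p \<le> n) * ?A (n - p)) + \<dots> =
      of_int (of_bool (p \<le> n) * ?A (n - p) +
        (\<Sum>i<p. of_bool (n = i * q) - of_bool (n = Suc (i * q))))"
    by (simp only: of_int_add)
  also have "\<dots> = of_int (?A n)"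
    unfolding rec[symmetric] by simp
  finally show ?case .
qed

section \<open>Entries of the words \<open>d_word\<close> and \<open>omega_word\<close>\<close>

lemma length_d_word: "p \<ge> 2 \<Longrightarrow> length (d_word p q i) = p"
  by (induction i) auto

lemma length_omega_word: "p \<ge> 2 \<Longrightarrow> length (omega_word p q i) = p"
  by (induction i) (auto simp: length_d_word word_add_def simp del: d_word.simps)

text \<open>Rotating by \<open>i * q\<close> shifts indices by \<open>i * q\<close> modulo
  \<open>p\<close>, and \<open>residue_diff p\<close> has period \<open>p\<close>, so the reduction
  may be dropped.\<close>

lemma nth_d_word:
  assumes "p \<ge> 2" "j < p"
  shows "d_word p q i ! j = residue_diff p (int (j + i * q))"
proof -
  have base: "d_word p q 0 ! k = residue_diff p (int k)" if "k < p" for k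
  proof -
    consider "k = 0" | "k = 1" | "k \<ge> 2"
      by linarith
    then show ?thesis
    proof cases
      case 3
      then have "\<not> int p dvd int k" "\<not> int p dvd int k - 1"
        using that by (auto dest: zdvd_imp_le)
      with 3 that show ?thesis
        by (auto simp: residue_diff_def nth_Cons' numeral_2_eq_2)
    qed (use assms in \<open>auto simp: residue_diff_def\<close>)
  qed
  have "d_word p q i ! j = d_word p q 0 ! ((i * q + j) mod p)"
    using assms length_d_word[of p q 0]
    by (subst d_word_eq_rotate) (simp add: nth_rotate del: d_word.simps)
  also have "\<dots> = residue_diff p (int ((i * q + j) mod p))"
    using assms by (intro base) simp
  also have "\<dots> = residue_diff p (int (j + i * q))"
    by (rule residue_diff_cong) (simp add: cong_def zmod_int add.commute)
  finally show ?thesis .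
qed

lemma nth_omega_word:
  assumes "p \<ge> 2" "j < p"
  shows "omega_word p q i ! j = (\<Sum>k\<le>i. residue_diff p (int (j + k * q)))"
proof (induction i)
  case 0
  then show ?case
    using nth_d_word[OF assms, of q 0] by simp
next
  case (Suc i)
  then show ?case
    using assms nth_d_word[OF assms, of q "Suc i"]
    by (simp add: word_add_def length_omega_word length_d_word distrib_right del: d_word.simps)
qed

text \<open>Entries involve \<open>q\<close> only through the residues of \<open>j + k * q\<close>
  modulo \<open>p\<close>. This gives the dependence on \<open>p\<close> and \<open>r\<close>
  alone.\<close>

lemma omega_word_cong:
  assumes "p \<ge> 2" "q' mod p = q mod p"
  shows "omega_word p q' i = omega_word p q i"
proof (rule nth_equalityI)
  fix j assume "j < length (omega_word p q' i)"
  then have "j < p"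
    using assms by (simp add: length_omega_word)
  have "residue_diff p (int (j + k * q')) = residue_diff p (int (j + k * q))" for k
  proof (rule residue_diff_cong)
    have "[j + k * q' = j + k * q] (mod p)"
      using assms(2) by (intro cong_add cong_mult cong_refl) (simp add: cong_def)
    then show "[int (j + k * q') = int (j + k * q)] (mod int p)"
      by (simp only: cong_int_iff)
  qed
  then show "omega_word p q' i ! j = omega_word p q i ! j"
    using \<open>j < p\<close> assms(1) by (simp only: nth_omega_word)
qed (use assms in \<open>simp add: length_omega_word\<close>)

text \<open>Turns a count of solutions into an indicator, which bounds it by
  \<open>1\<close>.\<close>

lemma sum_of_bool_at_most_one:
  assumes "finite A" "\<And>x y. x \<in> A \<Longrightarrow> y \<in> A \<Longrightarrow> P x \<Longrightarrow> P y \<Longrightarrow> x = y"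
  shows "(\<Sum>x\<in>A. of_bool (P x)) = (of_bool (\<exists>x\<in>A. P x) :: int)"
proof (cases "\<exists>x\<in>A. P x")
  case True
  then obtain a where "a \<in> A" "P a"
    by blast
  then have "(\<Sum>x\<in>A. of_bool (P x)) = (\<Sum>x\<in>A. if x = a then 1 else 0 :: int)"
    using assms(2) by (intro sum.cong) auto
  then show ?thesis
    using True \<open>a \<in> A\<close> assms(1) by simp
qed (auto intro!: sum.neutral)

text \<open>Coprimality lets \<open>q\<close> be cancelled modulo \<open>p\<close>. The integer
  offset \<open>c\<close> is later taken to be \<open>j\<close> for the letters \<open>1\<close> and
  \<open>j - 1\<close> for the letters \<open>-1\<close>; the latter may be negative.\<close>

lemma dvd_progression_unique:
  fixes p q x y :: nat and c :: int
  assumes "coprime p q" "x < p" "y < p"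
    and "int p dvd c + int (x * q)" "int p dvd c + int (y * q)"
  shows "x = y"
proof -
  have "int p dvd (int x - int y) * int q"
    using dvd_diff[OF assms(4,5)] by (simp add: algebra_simps)
  then have "int p dvd int x - int y"
    using assms(1) by (simp add: coprime_dvd_mult_left_iff)
  then have "int x mod int p = int y mod int p"
    by (simp add: mod_eq_dvd_iff)
  then show ?thesis
    using assms(2,3) by simp
qed

text \<open>
  As \<open>q\<close> is invertible modulo \<open>p\<close>, the residues of \<open>j + k * q\<close> for \<open>k < p\<close> are distinct, so each
  coordinate receives at most one \<open>1\<close> and at most one \<open>-1\<close>.
\<close>

lemma nth_omega_word_of_bool:
  assumes "p \<ge> 2" "j < p" "coprime p q" "i < p"
  shows "omega_word p q i ! j =
    of_bool (\<exists>k\<le>i. int p dvd int (j + k * q)) - of_bool (\<exists>k\<le>i. int p dvd int (j + k * q) - 1)"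
proof -
  have "(\<Sum>k\<le>i. of_bool (int p dvd int (j + k * q))) =
      (of_bool (\<exists>k\<in>{..i}. int p dvd int (j + k * q)) :: int)"
    using assms by (intro sum_of_bool_at_most_one)
      (auto intro: dvd_progression_unique[of p q _ _ "int j"])
  moreover have "(\<Sum>k\<le>i. of_bool (int p dvd int (j + k * q) - 1)) =
      (of_bool (\<exists>k\<in>{..i}. int p dvd int (j + k * q) - 1) :: int)"
    using assms by (intro sum_of_bool_at_most_one)
      (auto intro: dvd_progression_unique[of p q _ _ "int j - 1"] simp: algebra_simps)
  ultimately show ?thesis
    using assms by (simp only: nth_omega_word residue_diff_def sum_subtractf atMost_iff Bex_def)
qed

lemma omega_word_in_nlists:
  assumes "p \<ge> 2" "coprime p q" "i < p"
  shows "omega_word p q i \<in> nlists p {-1, 0, 1}"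
proof -
  have "of_bool P - of_bool Q \<in> {-1, 0, 1 :: int}" for P Q
    by simp
  then have "omega_word p q i ! j \<in> {-1, 0, 1}" if "j < p" for j
    unfolding nth_omega_word_of_bool[OF assms(1) that assms(2,3)] .
  then show ?thesis
    using assms(1) by (metis in_set_conv_nth length_omega_word nlistsI subsetI)
qed

text \<open>A forbidden addition would produce an entry \<open>2\<close> or \<open>-2\<close> in the
  next word, which is already known to have entries in \<open>{-1, 0, 1}\<close>.\<close>

lemma omega_word_add_no_overflow:
  assumes "p \<ge> 2" "coprime p q" "j < p" "0 < i" "i < p"
  shows "\<not> (omega_word p q (i - 1) ! j = 1 \<and> d_word p q i ! j = 1)"
    and "\<not> (omega_word p q (i - 1) ! j = -1 \<and> d_word p q i ! j = -1)"
proof -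
  have "omega_word p q i ! j = omega_word p q (i - 1) ! j + d_word p q i ! j"
    using assms
    by (cases i) (auto simp: word_add_def length_omega_word length_d_word simp del: d_word.simps)
  moreover have "omega_word p q i ! j \<in> {-1, 0, 1}"
    using omega_word_in_nlists[OF assms(1,2,5)] assms(3) by (rule nlistsE_nth_in)
  ultimately show "\<not> (omega_word p q (i - 1) ! j = 1 \<and> d_word p q i ! j = 1)"
    and "\<not> (omega_word p q (i - 1) ! j = -1 \<and> d_word p q i ! j = -1)"
    by auto
qed

section \<open>Fractional powers and concatenation of blocks by index\<close>

text \<open>A fractional power is a prefix of the infinite periodic repetition of \<open>v\<close>,
  so both branches of \<open>frac_pow\<close> reduce to one indexed form.\<close>

lemma frac_pow_eq_map:
  assumes "v \<noteq> []"
  shows "frac_pow v k = map (\<lambda>t. v ! (t mod length v)) [0..<k]"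
proof -
  let ?g = "\<lambda>t. v ! (t mod length v)"
  have take: "take m v = map ?g [0..<m]" if "m \<le> length v" for m
    using that by (auto intro: nth_equalityI)
  have pow: "word_pow v s @ take m v = map ?g [0..<s * length v + m]" if "m \<le> length v" for s m
  proof (induction s)
    case 0
    then show ?case
      using take[OF that] by (simp add: word_pow_def)
  next
    case (Suc s)
    have "[0..<Suc s * length v + m] =
        [0..<length v] @ map (\<lambda>t. t + length v) [0..<s * length v + m]"
      using upt_add_eq_append[of 0 "length v" "s * length v + m"]
      by (simp add: map_add_upt add_ac)
    then have "map ?g [0..<Suc s * length v + m] = map ?g [0..<length v] @ map ?g [0..<s * length v + m]"
      by simp
    then show ?case
      using Suc take[of "length v"] by (simp add: word_pow_def)
  qed
  show ?thesis
    using take[of k] pow[of "k mod length v" "k div length v"] assms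
    by (auto simp: frac_pow_def)
qed

lemma concat_map_blocks:
  fixes q m :: nat
  shows "concat (map (\<lambda>i. map (f i) [0..<q]) [0..<m]) =
    map (\<lambda>n. f (n div q) (n mod q)) [0..<m * q]"
proof (induction m)
  case (Suc m)
  have "[0..<Suc m * q] = [0..<m * q] @ map (\<lambda>t. t + m * q) [0..<q]"
    using upt_add_eq_append[of 0 "m * q" q] by (simp add: map_add_upt add_ac)
  then show ?case
    using Suc by (auto intro: map_cong)
qed simp

text \<open>Since \<open>p \<le> q\<close>, the power with exponent \<open>q / p\<close> falls into
  the second branch of \<open>frac_pow\<close>, while \<open>q mod p < p\<close> makes the inner one
  a plain prefix.\<close>

lemma b_word_eq_concat_frac_pow:
  assumes "p \<ge> 2" "p \<le> q"
  shows "b_word p q = concat (map (\<lambda>i. frac_pow (omega_word p q i) q) [0..<p - 1])"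
  using assms by (simp add: b_word_def frac_pow_def length_omega_word)

section \<open>The cyclotomic word and the final comparison\<close>

lemma totient_prime_mult:
  fixes p q :: nat
  assumes "prime p" "prime q" "p \<noteq> q"
  shows "totient (p * q) = (p - 1) * (q - 1)"
  using assms by (simp add: totient_mult_coprime primes_coprime totient_prime)

text \<open>Ensures that the cyclotomic word is no longer than \<open>b_word p q\<close>.\<close>

lemma pred_mult_pred_less:
  fixes p q :: nat
  assumes "1 < p" "0 < q"
  shows "(p - 1) * (q - 1) + 1 \<le> (p - 1) * q"
proof -
  have "(p - 1) * (q - 1) + (p - 1) = (p - 1) * q"
    using assms by (cases q) simp_all
  then show ?thesis
    using assms by linarith
qed

lemma cyclotomic_word_eq_map:
  fixes p q :: nat
  assumes "prime p" "prime q" "p < q"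
  shows "cyclotomic_word (p * q) =
    map of_int (map (\<lambda>n. omega_word p q (n div q) ! (n mod q mod p)) [0..<(p - 1) * (q - 1) + 1])"
proof (rule nth_equalityI)
  have tot: "totient (p * q) = (p - 1) * (q - 1)"
    using assms by (simp add: totient_prime_mult)
  then show "length (cyclotomic_word (p * q)) = length (map of_int
      (map (\<lambda>n. omega_word p q (n div q) ! (n mod q mod p)) [0..<(p - 1) * (q - 1) + 1]))"
    by (simp add: length_cyclotomic_word)
  fix n assume "n < length (cyclotomic_word (p * q))"
  then have n: "n < (p - 1) * (q - 1) + 1"
    by (simp add: length_cyclotomic_word tot)
  have "cyclotomic (p * q) \<noteq> 0"
    by (auto simp: cyclotomic_def)
  then have nth_word: "cyclotomic_word (p * q) ! n = coeff (cyclotomic (p * q)) n"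
    using n by (simp add: cyclotomic_word_def coeffs_nth degree_cyclotomic tot)
  have p2: "p \<ge> 2"
    using assms prime_ge_2_nat by blast
  have "(p - 1) * (q - 1) + 1 \<le> (p - 1) * q"
    using assms p2 by (intro pred_mult_pred_less) simp_all
  then have "n < p * q"
    using n by (metis diff_le_self less_le_trans mult_le_mono1)
  define k where "k = n div q"
  \<comment> \<open>With \<open>k < p\<close>, the guard \<open>i * q \<le> n\<close> cuts the sum
    over \<open>i < p\<close> down to exactly the indices \<open>i \<le> k\<close>.\<close>
  have k: "k < p"
    using \<open>n < p * q\<close> by (simp add: k_def less_mult_imp_div_less)
  have le_k: "i * q \<le> n \<longleftrightarrow> i \<le> k" for i
    using assms by (simp add: k_def less_eq_div_iff_mult_less_eq)
  have "(\<Sum>i<p. of_bool (i * q \<le> n) * residue_diff p (int n - int (i * q))) =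
      (\<Sum>i\<le>k. residue_diff p (int n - int (i * q)))"
    using k by (intro sum.mono_neutral_cong_right) (auto simp: le_k)
  \<comment> \<open>Reversal makes each argument equal to \<open>n mod q + i * q\<close>, a form in
    which only the residue of \<open>n mod q\<close> modulo \<open>p\<close> matters.\<close>
  also have "\<dots> = (\<Sum>i\<le>k. residue_diff p (int n - int ((k - i) * q)))"
    by (rule sum.reindex_bij_witness[where i = "\<lambda>i. k - i" and j = "\<lambda>i. k - i"]) auto
  also have "\<dots> = (\<Sum>i\<le>k. residue_diff p (int (n mod q mod p + i * q)))"
  proof (intro sum.cong refl residue_diff_cong)
    fix i assume "i \<in> {..k}"
    then have "k * q = (k - i) * q + i * q"
      by (simp add: add_mult_distrib[symmetric])
    moreover have "n = k * q + n mod q"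
      by (simp add: k_def)
    ultimately have "int n - int ((k - i) * q) = int (n mod q + i * q)"
      by linarith
    moreover have "[n mod q + i * q = n mod q mod p + i * q] (mod p)"
      by (simp add: cong_def mod_simps)
    ultimately show "[int n - int ((k - i) * q) = int (n mod q mod p + i * q)] (mod int p)"
      by (simp only: cong_int_iff)
  qed
  also have "\<dots> = omega_word p q k ! (n mod q mod p)"
    using p2 by (simp add: nth_omega_word)
  finally show "cyclotomic_word (p * q) ! n = map of_int
      (map (\<lambda>n. omega_word p q (n div q) ! (n mod q mod p)) [0..<(p - 1) * (q - 1) + 1]) ! n"
    using n coeff_cyclotomic_prime_mult[of p q n] assms
    by (simp add: nth_word k_def del: upt_Suc)
qed

theorem theorem1:
  fixes p q :: nat
  assumes "prime p" and "prime q" and "p < q"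
  shows "(\<forall>i\<le>p - 2. omega_word p q i \<in> nlists p {-1, 0, 1}) \<and>
    (\<forall>i\<in>{1..p - 2}. \<forall>j<p.
       \<not> (omega_word p q (i - 1) ! j = 1 \<and> d_word p q i ! j = 1) \<and>
       \<not> (omega_word p q (i - 1) ! j = -1 \<and> d_word p q i ! j = -1)) \<and>
    (\<forall>q'. prime q' \<and> p < q' \<and> q' mod p = q mod p \<longrightarrow>
       (\<forall>i\<le>p - 2. omega_word p q' i = omega_word p q i)) \<and>
    b_word p q \<in> nlists ((p - 1) * q) {-1, 0, 1} \<and>
    cyclotomic_word (p * q) = map of_int (take (totient (p * q) + 1) (b_word p q)) \<and>
    cyclotomic_word (p * q) =
      map of_int (concat (map (\<lambda>i. frac_pow (omega_word p q i) q) [0..<p - 2])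
        @ frac_pow (omega_word p q (p - 2)) (q - p + 2))"
proof -
  have p2: "p \<ge> 2"
    using assms prime_ge_2_nat by blast
  have cop: "coprime p q"
    using assms by (simp add: primes_coprime)
  have tot: "totient (p * q) = (p - 1) * (q - 1)"
    using assms by (simp add: totient_prime_mult)
  \<comment> \<open>The letter at index \<open>n\<close> in the common indexed form:
    \<open>n div q\<close> selects the block and \<open>n mod q\<close> the place in it. All words
    compared below become \<open>map h\<close> over an initial segment.\<close>
  define h where "h n = omega_word p q (n div q) ! (n mod q mod p)" for n
  have frac: "frac_pow (omega_word p q i) m = map (\<lambda>t. omega_word p q i ! (t mod p)) [0..<m]" for i m
    using p2 length_omega_word[OF p2, of q i] by (subst frac_pow_eq_map) auto
  have blocks: "concat (map (\<lambda>i. frac_pow (omega_word p q i) q) [0..<m]) = map h [0..<m * q]" for m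
    unfolding frac h_def by (rule concat_map_blocks)
  have b: "b_word p q = map h [0..<(p - 1) * q]"
    using assms p2 by (simp add: b_word_eq_concat_frac_pow blocks)
  \<comment> \<open>The cyclotomic word fills \<open>p - 2\<close> complete blocks and
    \<open>q - p + 2\<close> letters of the next. Writing \<open>p = a + 2\<close> and
    \<open>q = p + c\<close> removes the truncated subtractions.\<close>
  have lenq: "(p - 1) * (q - 1) + 1 = (p - 2) * q + (q - p + 2)"
  proof -
    obtain a where a: "p = a + 2"
      using p2 by (metis add.commute le_Suc_ex)
    obtain c where "q = p + c"
      using assms(3) by (metis less_imp_add_positive)
    then show ?thesis
      by (simp add: a algebra_simps)
  qed
  have le: "(p - 1) * (q - 1) + 1 \<le> (p - 1) * q"
    using assms p2 by (intro pred_mult_pred_less) simp_all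
  have cyc: "cyclotomic_word (p * q) = map of_int (map h [0..<(p - 1) * (q - 1) + 1])"
    unfolding h_def by (rule cyclotomic_word_eq_map[OF assms])
  have "h n \<in> {-1, 0, 1}" if "n < (p - 1) * q" for n
  proof -
    have "n div q < p"
      using less_mult_imp_div_less[OF that] by simp
    then show ?thesis
      using nlistsE_nth_in[OF omega_word_in_nlists[OF p2 cop]] p2 by (simp add: h_def)
  qed
  then have "h ` {..<(p - 1) * q} \<subseteq> {-1, 0, 1}"
    by blast
  then have "b_word p q \<in> nlists ((p - 1) * q) {-1, 0, 1}"
    unfolding b by (intro nlistsI) (simp_all only: length_map length_upt set_map set_upt
        atLeast0LessThan diff_zero)
  moreover have "cyclotomic_word (p * q) = map of_int (take (totient (p * q) + 1) (b_word p q))"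
    unfolding cyc b tot using le by (simp add: take_map del: upt_Suc)
  moreover have "cyclotomic_word (p * q) =
      map of_int (concat (map (\<lambda>i. frac_pow (omega_word p q i) q) [0..<p - 2])
        @ frac_pow (omega_word p q (p - 2)) (q - p + 2))"
  proof -
    let ?m = "q - p + 2"
    have "map h [0..<(p - 2) * q + ?m] =
        map h [0..<(p - 2) * q] @ map h (map (\<lambda>t. t + (p - 2) * q) [0..<?m])"
      using upt_add_eq_append[of 0 "(p - 2) * q" ?m] by (simp add: map_add_upt add_ac del: upt_Suc)
    also have "map h (map (\<lambda>t. t + (p - 2) * q) [0..<?m]) = frac_pow (omega_word p q (p - 2)) ?m"
      unfolding frac map_map
    proof (intro map_cong refl)
      fix t assume "t \<in> set [0..<?m]"
      \<comment> \<open>Since \<open>p \<ge> 2\<close>, the last piece has length at most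
        \<open>q\<close>, so its indices stay inside block \<open>p - 2\<close>.\<close>
      then have "t < q"
        using p2 assms(3) by auto
      then show "(h \<circ> (\<lambda>t. t + (p - 2) * q)) t = omega_word p q (p - 2) ! (t mod p)"
        by (simp add: h_def)
    qed
    finally show ?thesis
      unfolding cyc lenq blocks by simp
  qed
  moreover have "omega_word p q i \<in> nlists p {-1, 0, 1}" if "i \<le> p - 2" for i
    using that p2 by (intro omega_word_in_nlists cop) simp_all
  moreover have "\<not> (omega_word p q (i - 1) ! j = 1 \<and> d_word p q i ! j = 1) \<and>
      \<not> (omega_word p q (i - 1) ! j = -1 \<and> d_word p q i ! j = -1)"
    if "i \<in> {1..p - 2}" "j < p" for i j
  proof -
    have "0 < i" "i < p"
      using that(1) p2 by auto
    then show ?thesis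
      using omega_word_add_no_overflow[OF p2 cop that(2)] by blast
  qed
  ultimately show ?thesis
    using omega_word_cong[OF p2] by blast
qed

end
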